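(* For all positive integers $n$, we have $c'_1(H(2,n)) = \left\lceil \frac{n+1}{3} \right\rceil$.
   Context: Graphs are finite and simple. For positive integers $d,n$, the Hamming graph $H(d,n)$ is the $d$-fold Cartesian product of $K_n$: its vertices are the $d$-tuples with entries in $\{1,\dots,n\}$, two being adjacent iff they differ in exactly one coordinate. $\ell$-visibility Cops and Robbers on a graph $G$ ($\ell$ a nonnegative integer): a team of one or more cops and a single robber occupy vertices of $G$ (several cops may share a vertex). First the cops choose initial positions, then the robber, knowing them, chooses his. Thereafter the game proceeds in rounds, each a cop turn (each cop stays or moves to an adjacent vertex) followed by a robber turn (the robber stays or moves to an adjacent vertex). The robber always knows the cops' positions. The robber's position is unknown to the cops unless some cop is at distance at most $\ell$ from him; in that case the cops see the robber and all cops know his position. (A cop sees a vertex if she is within distance $\ell$ of it.) $c'_\ell(G)$ denotes the minimum number of cops having a strategy that guarantees that, within a finite number of rounds and regardless of how the robber plays (equivalently, even if he can anticipate the cops' moves), some cop sees the robber. Equivalently, it is the least $k$ for which $k$ cops can clean all vertices: after the initial placement the dirty vertices are those not within distance $\ell$ of a cop; in each cop turn, dirty vertices that are seen by cops in their new positions become clean; in each robber turn, every clean vertex that is adjacent to a dirty vertex and is not within distance $\ell$ of a cop becomes dirty. *)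

theory Defs
  imports "Graph_Theory.Graph_Theory" Complex_Main
begin

text \<open>Finite simple graphs are the instances of the locale \<^locale>\<open>pair_graph\<close> of Graph_Theory
  (finite symmetric digraphs without loops or parallel arcs). Two vertices are adjacent iff the
  pair belongs to \<^term>\<open>parcs G\<close>.\<close>

definition hamming_graph :: "nat \<Rightarrow> nat \<Rightarrow> nat list pair_pre_digraph" where
  "hamming_graph d n =
    (let V = {xs. length xs = d \<and> set xs \<subseteq> {1..n}}
     in \<lparr> pverts = V,
          parcs = {(xs, ys). xs \<in> V \<and> ys \<in> V \<and> card {i. i < d \<and> xs ! i \<noteq> ys ! i} = 1} \<rparr>)"

lemma pair_graph_hamming_graph: "pair_graph (hamming_graph d n)"
proof -
  let ?V = "{xs::nat list. length xs = d \<and> set xs \<subseteq> {1..n}}"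
  let ?E = "parcs (hamming_graph d n)"
  have fin: "finite ?V"
    using finite_lists_length_eq[of "{1..n}" d] by (simp add: conj_commute)
  have sub: "?E \<subseteq> ?V \<times> ?V"
    by (auto simp: hamming_graph_def Let_def)
  have swap: "{i. i < d \<and> xs ! i \<noteq> ys ! i} = {i. i < d \<and> ys ! i \<noteq> xs ! i}" for xs ys :: "nat list"
    by auto
  have symE: "(y, x) \<in> ?E" if "(x, y) \<in> ?E" for x y
    using that swap[of x y] by (simp add: hamming_graph_def Let_def)
  have verts: "pverts (hamming_graph d n) = ?V"
    by (simp add: hamming_graph_def Let_def)
  show ?thesis
  proof
    show "finite (pverts (hamming_graph d n))"
      using fin verts by simp
    show "finite ?E"
      using fin sub by (meson finite_SigmaI finite_subset)
    show "symmetric (hamming_graph d n)"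
      using symE by (auto simp: symmetric_def intro: symI)
    fix e
    assume e: "e \<in> ?E"
    have "e \<in> ?V \<times> ?V"
      by (rule subsetD[OF sub e])
    then show "fst e \<in> pverts (hamming_graph d n)" "snd e \<in> pverts (hamming_graph d n)"
      unfolding verts mem_Times_iff by (rule conjunct1, rule conjunct2)
    show "fst e \<noteq> snd e"
    proof
      assume "fst e = snd e"
      with e have "card {i. i < d \<and> fst e ! i \<noteq> fst e ! i} = 1"
        by (simp add: hamming_graph_def Let_def case_prod_unfold)
      then show False by simp
    qed
  qed
qed


context pair_graph
begin

text \<open>\<^term>\<open>\<mu>\<close> with unit arc weights is the graph distance.\<close>

definition in_view :: "nat \<Rightarrow> 'a \<Rightarrow> 'a \<Rightarrow> bool" where
  "in_view l u v \<longleftrightarrow> \<mu> (\<lambda>_. 1) u v \<le> ereal (real l)"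

lemma in_view_iff_awalk: "in_view l u v \<longleftrightarrow> (\<exists>p. awalk u p v \<and> length p \<le> l)"
proof -
  have cost: "awalk_cost (\<lambda>_. 1) p = real (length p)" for p :: "('a \<times> 'a) list"
    by (induct p) auto
  show ?thesis
  proof
    assume *: "in_view l u v"
    show "\<exists>p. awalk u p v \<and> length p \<le> l"
    proof (rule ccontr)
      assume "\<not> ?thesis"
      then have "ereal (real l + 1) \<le> \<mu> (\<lambda>_. 1) u v"
        unfolding \<mu>_def cost by (intro INF_greatest) (auto simp: not_le Suc_le_eq[symmetric] simp flip: of_nat_Suc)
      then have "ereal (real l + 1) \<le> ereal (real l)"
        using * order_trans unfolding in_view_def by blast
      then show False by simp
    qed
  next
    assume "\<exists>p. awalk u p v \<and> length p \<le> l"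
    then obtain p where p: "awalk u p v" "length p \<le> l" by blast
    have "\<mu> (\<lambda>_. 1) u v \<le> ereal (real (length p))"
      using min_cost_le_walk_cost[OF p(1), of "\<lambda>_. 1"] by (simp add: cost)
    also have "\<dots> \<le> ereal (real l)" using p(2) by simp
    finally show "in_view l u v" by (simp add: in_view_def)
  qed
qed

definition player_walk :: "(nat \<Rightarrow> 'a) \<Rightarrow> bool" where
  "player_walk w \<longleftrightarrow>
    w 0 \<in> pverts G \<and> (\<forall>t. w (Suc t) = w t \<or> (w t, w (Suc t)) \<in> parcs G)"

text \<open>\<^term>\<open>c i t\<close> is the position of cop \<^term>\<open>i\<close> (for \<^term>\<open>i < k\<close>) after round \<^term>\<open>t\<close>,
  round \<open>0\<close> being the initial placement.\<close>

definition seen :: "nat \<Rightarrow> nat \<Rightarrow> (nat \<Rightarrow> nat \<Rightarrow> 'a) \<Rightarrow> nat \<Rightarrow> 'a \<Rightarrow> bool" where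
  "seen l k c t v \<longleftrightarrow> (\<exists>i<k. in_view l (c i t) v)"

text \<open>The second disjunct is the moment in round \<^term>\<open>Suc t\<close> when the cops have moved and the
  robber has not.\<close>

definition seen_by_round :: "nat \<Rightarrow> nat \<Rightarrow> (nat \<Rightarrow> nat \<Rightarrow> 'a) \<Rightarrow> (nat \<Rightarrow> 'a) \<Rightarrow> nat \<Rightarrow> bool" where
  "seen_by_round l k c r T \<longleftrightarrow>
    (\<exists>t\<le>T. seen l k c t (r t)) \<or> (\<exists>t<T. seen l k c (Suc t) (r t))"

text \<open>Until some cop sees the robber the cops learn nothing about him, so a strategy for seeing him
  is a fixed sequence of cop positions. The robber walk is chosen after it, which covers every
  robber strategy, including those that anticipate the cops' moves.\<close>

definition cops_can_see_robber :: "nat \<Rightarrow> nat \<Rightarrow> bool" where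
  "cops_can_see_robber l k \<longleftrightarrow>
    (\<exists>c T. (\<forall>i<k. player_walk (c i)) \<and> (\<forall>r. player_walk r \<longrightarrow> seen_by_round l k c r T))"

text \<open>On a nonempty graph the minimum exists, as one cop on each vertex suffices.\<close>

definition seeing_cop_number :: "nat \<Rightarrow> nat" where
  "seeing_cop_number l = (LEAST k. 1 \<le> k \<and> cops_can_see_robber l k)"


text \<open>\<^term>\<open>dirty l k c t\<close> is the dirty set after round \<^term>\<open>t\<close> of the equivalent cleaning process.\<close>

primrec dirty :: "nat \<Rightarrow> nat \<Rightarrow> (nat \<Rightarrow> nat \<Rightarrow> 'a) \<Rightarrow> nat \<Rightarrow> 'a set" where
  "dirty l k c 0 = {v \<in> pverts G. \<not> seen l k c 0 v}"
| "dirty l k c (Suc t) =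
    (let D = {v \<in> dirty l k c t. \<not> seen l k c (Suc t) v}
     in D \<union> {v \<in> pverts G. (\<exists>u \<in> D. (u, v) \<in> parcs G) \<and> \<not> seen l k c (Suc t) v})"

lemma dirty_iff_unseen_robber:
  "v \<in> dirty l k c T \<longleftrightarrow> (\<exists>r. player_walk r \<and> r T = v \<and> \<not> seen_by_round l k c r T)"
proof (induct T arbitrary: v)
  case 0
  show ?case
  proof
    assume "v \<in> dirty l k c 0"
    then show "\<exists>r. player_walk r \<and> r 0 = v \<and> \<not> seen_by_round l k c r 0"
      by (intro exI[of _ "\<lambda>_. v"]) (simp add: player_walk_def seen_by_round_def)
  qed (auto simp: player_walk_def seen_by_round_def)
next
  case (Suc T)
  have step: "v \<in> dirty l k c (Suc T) \<longleftrightarrow>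
      (\<exists>u \<in> dirty l k c T. \<not> seen l k c (Suc T) u \<and> \<not> seen l k c (Suc T) v \<and>
        (v = u \<or> (u, v) \<in> parcs G))"
    by (auto simp: Let_def dest: in_arcsD2)
  show ?case
  proof
    assume "v \<in> dirty l k c (Suc T)"
    then obtain u where u: "u \<in> dirty l k c T" "\<not> seen l k c (Suc T) u" "\<not> seen l k c (Suc T) v"
      "v = u \<or> (u, v) \<in> parcs G" using step by blast
    then obtain r where r: "player_walk r" "r T = u" "\<not> seen_by_round l k c r T"
      using Suc by blast
    define r' where "r' t = (if t \<le> T then r t else v)" for t
    have "player_walk r'"
      unfolding player_walk_def
    proof (intro conjI allI)
      show "r' 0 \<in> pverts G"
        using r(1) by (simp add: r'_def player_walk_def)
      fix t
      consider "t < T" | "t = T" | "t > T" by linarith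
      then show "r' (Suc t) = r' t \<or> (r' t, r' (Suc t)) \<in> parcs G"
        using r(1,2) u(4) by cases (auto simp: r'_def player_walk_def)
    qed
    moreover have "\<not> seen_by_round l k c r' (Suc T)"
      using r(2,3) u(2,3) by (auto simp: seen_by_round_def r'_def le_Suc_eq less_Suc_eq le_less)
    ultimately show "\<exists>r. player_walk r \<and> r (Suc T) = v \<and> \<not> seen_by_round l k c r (Suc T)"
      by (intro exI[of _ r']) (simp add: r'_def)
  next
    assume "\<exists>r. player_walk r \<and> r (Suc T) = v \<and> \<not> seen_by_round l k c r (Suc T)"
    then obtain r where r: "player_walk r" "r (Suc T) = v" "\<not> seen_by_round l k c r (Suc T)"
      by blast
    then have "r T \<in> dirty l k c T"
      unfolding Suc by (auto simp: seen_by_round_def intro!: exI[of _ r])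
    with r show "v \<in> dirty l k c (Suc T)"
      unfolding step by (intro bexI[of _ "r T"]) (auto simp: player_walk_def seen_by_round_def)
  qed
qed

lemma cops_can_see_robber_iff_clean:
  "cops_can_see_robber l k \<longleftrightarrow> (\<exists>c T. (\<forall>i<k. player_walk (c i)) \<and> dirty l k c T = {})"
proof -
  have "dirty l k c T = {} \<longleftrightarrow> (\<forall>r. player_walk r \<longrightarrow> seen_by_round l k c r T)" for c T
    unfolding set_eq_iff dirty_iff_unseen_robber by simp
  then show ?thesis
    unfolding cops_can_see_robber_def by simp
qed

end

end

theory Submission
  imports Defs
begin

text \<open>
  A cop on the \<open>n \<times> n\<close> board \<open>H(2,n)\<close> sees her row and her column, and a player's step
  changes at most one coordinate. Hence both sight and movement are the relation \<^term>\<open>collinear\<close>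
  below, and the unseen cells always form a rectangle \<open>R \<times> S\<close>, where \<open>R\<close> and \<open>S\<close> are the rows and
  the columns without cops. The theorem follows from the claim that \<open>k \<ge> 1\<close> cops suffice exactly
  when \<open>n < 3k\<close>.

  Suppose \<open>3k \<le> n\<close>. In one round at most \<open>k\<close> lines change from occupied to free, since a cop
  leaves either a row or a column but not both. Suppose that the clean unseen cells lie in a
  rectangle \<open>A \<times> B\<close> with \<open>|A| + |B| \<le> k\<close>. This rectangle is either empty or has fewer than \<open>k\<close>
  columns, while at least \<open>n - 2k \<ge> k\<close> columns are free both before and after the cops' turn.
  So some completely dirty column stays free, and through it the robber reaches every cell of each
  row that was free before and after; the same holds with rows and columns exchanged. The only
  clean unseen cells are then those in a freshly freed row and a freshly freed column, again a
  rectangle \<open>A' \<times> B'\<close> with \<open>|A'| + |B'| \<le> k\<close>. The board is thus never clean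
  (\<open>few_cops_fail\<close>).

  Suppose \<open>n < 3k\<close>. Cop \<open>0\<close> sweeps the rows from \<open>1\<close> upwards, and each row that she leaves must be
  protected for ever. A set of rows is protected if no dirty cell of it survives the cops' turn.
  The other \<open>k - 1\<close> cops keep their rows, which are the last ones, and rotate through
  three blocks of \<open>k - 1\<close> columns, while cop \<open>0\<close> alternates between the two remaining columns in
  the rounds in which she does not change her row. In a swept row the cells of the block just left
  are clean, those of the present block are seen, and those of the third block are about to be
  seen. So the dirt in swept rows is removed in every turn, before it can spread
  (\<open>dirty_invariant\<close>). The board is clean when the sweep is complete.
\<close>

section \<open>The rook's graph\<close>

interpretation rook: pair_graph "hamming_graph 2 n" for n
  by (rule pair_graph_hamming_graph)

definition collinear :: "nat list \<Rightarrow> nat list \<Rightarrow> bool" where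
  "collinear u v \<longleftrightarrow> u ! 0 = v ! 0 \<or> u ! 1 = v ! 1"

lemma collinear_Cons [simp]: "collinear [a, b] [c, d] \<longleftrightarrow> a = c \<or> b = d"
  by (simp add: collinear_def)

lemma mem_pverts_rook:
  "v \<in> pverts (hamming_graph 2 n) \<longleftrightarrow> (\<exists>x\<in>{1..n}. \<exists>y\<in>{1..n}. v = [x, y])"
  by (auto simp: hamming_graph_def Let_def numeral_2_eq_2 length_Suc_conv)

lemma Cons_mem_pverts_rook [simp]:
  "[x, y] \<in> pverts (hamming_graph 2 n) \<longleftrightarrow> x \<in> {1..n} \<and> y \<in> {1..n}"
  by (auto simp: mem_pverts_rook)

lemma eq_or_adjacent_iff_collinear:
  assumes "u \<in> pverts (hamming_graph 2 n)" "v \<in> pverts (hamming_graph 2 n)"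
  shows "v = u \<or> (u, v) \<in> parcs (hamming_graph 2 n) \<longleftrightarrow> collinear u v"
proof -
  obtain a b c d where [simp]: "u = [a, b]" "v = [c, d]"
    using assms by (auto simp: mem_pverts_rook)
  have "{i. i < 2 \<and> u ! i \<noteq> v ! i} = (if a = c then {} else {0}) \<union> (if b = d then {} else {1})"
    by (auto simp: less_2_cases_iff)
  then have "(u, v) \<in> parcs (hamming_graph 2 n) \<longleftrightarrow>
      card ((if a = c then {} else {0}) \<union> (if b = d then {} else {1 :: nat})) = 1"
    using assms by (simp add: hamming_graph_def Let_def)
  then show ?thesis by auto
qed

lemma (in pair_graph) in_view_1_iff:
  "in_view 1 u v \<longleftrightarrow> u \<in> pverts G \<and> (v = u \<or> (u, v) \<in> parcs G)"
proof
  assume "in_view 1 u v"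
  then obtain p where p: "awalk u p v" "length p \<le> 1"
    by (auto simp: in_view_iff_awalk)
  then show "u \<in> pverts G \<and> (v = u \<or> (u, v) \<in> parcs G)"
    by (cases p) (auto simp: awalk_def)
next
  assume R: "u \<in> pverts G \<and> (v = u \<or> (u, v) \<in> parcs G)"
  show "in_view 1 u v"
  proof (cases "v = u")
    case True
    with R show ?thesis
      unfolding in_view_iff_awalk by (intro exI[of _ "[]"]) (simp add: awalk_def)
  next
    case False
    with R show ?thesis
      unfolding in_view_iff_awalk
      by (intro exI[of _ "[(u, v)]"]) (auto simp: awalk_def dest: in_arcsD2)
  qed
qed

lemma rook_in_view_iff:
  assumes "u \<in> pverts (hamming_graph 2 n)" "v \<in> pverts (hamming_graph 2 n)"
  shows "rook.in_view n 1 u v \<longleftrightarrow> collinear u v"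
  using eq_or_adjacent_iff_collinear[OF assms] assms unfolding rook.in_view_1_iff by simp

lemma rook_player_walk_iff:
  "rook.player_walk n w \<longleftrightarrow>
    (\<forall>t. w t \<in> pverts (hamming_graph 2 n) \<and> collinear (w t) (w (Suc t)))"
proof
  assume w: "rook.player_walk n w"
  have V: "w t \<in> pverts (hamming_graph 2 n)" for t
  proof (induct t)
    case (Suc t)
    with w show ?case
      unfolding rook.player_walk_def by (metis rook.in_arcsD2)
  qed (use w in \<open>simp add: rook.player_walk_def\<close>)
  with w show "\<forall>t. w t \<in> pverts (hamming_graph 2 n) \<and> collinear (w t) (w (Suc t))"
    by (metis eq_or_adjacent_iff_collinear rook.player_walk_def)
next
  assume "\<forall>t. w t \<in> pverts (hamming_graph 2 n) \<and> collinear (w t) (w (Suc t))"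
  then show "rook.player_walk n w"
    by (metis eq_or_adjacent_iff_collinear rook.player_walk_def)
qed

lemma rook_seen_iff:
  assumes "\<forall>i<k. rook.player_walk n (c i)" "v \<in> pverts (hamming_graph 2 n)"
  shows "rook.seen n 1 k c t v \<longleftrightarrow> (\<exists>i<k. collinear (c i t) v)"
  using assms rook_in_view_iff unfolding rook.seen_def rook_player_walk_iff by metis

lemma dirty_subset_pverts: "rook.dirty n l k c t \<subseteq> pverts (hamming_graph 2 n)"
  by (induct t) (auto simp: Let_def)

lemma mem_dirty_imp_unseen: "v \<in> rook.dirty n l k c t \<Longrightarrow> \<not> rook.seen n l k c t v"
  by (cases t) (auto simp: Let_def)

lemma mem_dirty_Suc_iff:
  assumes "v \<in> pverts (hamming_graph 2 n)"
  shows "v \<in> rook.dirty n l k c (Suc t) \<longleftrightarrow> \<not> rook.seen n l k c (Suc t) v \<and>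
    (\<exists>u \<in> rook.dirty n l k c t. \<not> rook.seen n l k c (Suc t) u \<and> collinear u v)"
proof -
  have "v \<in> rook.dirty n l k c (Suc t) \<longleftrightarrow> \<not> rook.seen n l k c (Suc t) v \<and>
    (\<exists>u \<in> rook.dirty n l k c t. \<not> rook.seen n l k c (Suc t) u \<and>
      (v = u \<or> (u, v) \<in> parcs (hamming_graph 2 n)))"
    using assms by (auto simp: Let_def)
  also have "\<dots> \<longleftrightarrow> \<not> rook.seen n l k c (Suc t) v \<and>
    (\<exists>u \<in> rook.dirty n l k c t. \<not> rook.seen n l k c (Suc t) u \<and> collinear u v)"
    using eq_or_adjacent_iff_collinear[OF _ assms] dirty_subset_pverts by blast
  finally show ?thesis .
qed

section \<open>At most n / 3 cops never clean the board\<close>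

text \<open>The rows (\<open>j = 0\<close>) or columns (\<open>j = 1\<close>) that no cop occupies; the unseen cells are those whose
  two coordinates are both free.\<close>

definition free_lines :: "nat \<Rightarrow> nat \<Rightarrow> (nat \<Rightarrow> nat \<Rightarrow> nat list) \<Rightarrow> nat \<Rightarrow> nat \<Rightarrow> nat set" where
  "free_lines n k c t j = {1..n} - (\<lambda>i. c i t ! j) ` {..<k}"

lemma unseen_iff_free_lines:
  assumes "\<forall>i<k. rook.player_walk n (c i)" "x \<in> {1..n}" "y \<in> {1..n}"
  shows "\<not> rook.seen n 1 k c t [x, y] \<longleftrightarrow>
    x \<in> free_lines n k c t 0 \<and> y \<in> free_lines n k c t 1"
  using assms(2,3) by (subst rook_seen_iff[OF assms(1)]) (auto simp: free_lines_def collinear_def)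

text \<open>Two occupations and a set \<open>B\<close> with fewer than \<open>k\<close> elements exclude fewer than \<open>3k\<close> lines.\<close>

lemma ex_line_free_twice:
  assumes "3 * k \<le> n" "finite B" "card B < k"
  shows "\<exists>y. y \<in> free_lines n k c t j \<and> y \<in> free_lines n k c t' j \<and> y \<notin> B"
proof -
  let ?O = "\<lambda>t. (\<lambda>i. c i t ! j) ` {..<k}"
  have "card (?O t \<union> ?O t' \<union> B) \<le> card (?O t) + card (?O t') + card B"
    by (meson add_le_mono1 card_Un_le order_trans)
  also have "\<dots> < card {1..n}"
    using assms card_image_le[of "{..<k}" "\<lambda>i. c i t ! j"]
      card_image_le[of "{..<k}" "\<lambda>i. c i t' ! j"] by simp
  finally have "\<not> {1..n} \<subseteq> ?O t \<union> ?O t' \<union> B"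
    using assms(2) by (meson card_mono finite_UnI finite_imageI finite_lessThan not_le)
  then show ?thesis
    by (auto simp: free_lines_def)
qed

text \<open>A line is freed only by a cop who leaves it, and in one step a cop keeps one of her two
  coordinates.\<close>

lemma card_freed_lines_le:
  assumes "\<forall>i<k. rook.player_walk n (c i)"
  shows "card (free_lines n k c (Suc t) 0 - free_lines n k c t 0) +
    card (free_lines n k c (Suc t) 1 - free_lines n k c t 1) \<le> k"
proof -
  define M where "M j = {i. i < k \<and> c i t ! j \<noteq> c i (Suc t) ! j}" for j
  have fin: "finite (M j)" for j
    by (simp add: M_def)
  have "free_lines n k c (Suc t) j - free_lines n k c t j \<subseteq> (\<lambda>i. c i t ! j) ` M j" for j
    by (auto simp: free_lines_def M_def)
  then have freed: "card (free_lines n k c (Suc t) j - free_lines n k c t j) \<le> card (M j)" for j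
    by (rule surj_card_le[OF fin])
  have "M 0 \<inter> M 1 = {}"
    using assms by (auto simp: M_def rook_player_walk_iff collinear_def)
  then have "card (M 0) + card (M 1) = card (M 0 \<union> M 1)"
    by (simp add: card_Un_disjoint fin)
  also have "\<dots> \<le> card {..<k}"
    by (rule card_mono) (auto simp: M_def)
  finally show ?thesis
    using freed[of 0] freed[of 1] by simp
qed

definition clean_within :: "nat \<Rightarrow> nat \<Rightarrow> (nat \<Rightarrow> nat \<Rightarrow> nat list) \<Rightarrow> nat \<Rightarrow> nat set \<Rightarrow> nat set \<Rightarrow> bool" where
  "clean_within n k c t A B \<longleftrightarrow>
    (\<forall>x \<in> free_lines n k c t 0. \<forall>y \<in> free_lines n k c t 1.
      [x, y] \<in> rook.dirty n 1 k c t \<or> x \<in> A \<and> y \<in> B)"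

text \<open>If one side of the rectangle \<open>A \<times> B\<close> has all \<open>k\<close> elements, then the other side is empty and
  nothing is clean; otherwise both sides are too short to cover all lines that stay free.\<close>

lemma ex_surviving_dirty_lines:
  assumes "3 * k \<le> n" "1 \<le> k" "finite A" "finite B" "card A + card B \<le> k"
    and clean: "clean_within n k c t A B"
  obtains x y where
    "x \<in> free_lines n k c t 0" "x \<in> free_lines n k c (Suc t) 0"
    "\<And>y'. y' \<in> free_lines n k c t 1 \<Longrightarrow> [x, y'] \<in> rook.dirty n 1 k c t"
    "y \<in> free_lines n k c t 1" "y \<in> free_lines n k c (Suc t) 1"
    "\<And>x'. x' \<in> free_lines n k c t 0 \<Longrightarrow> [x', y] \<in> rook.dirty n 1 k c t"
proof -
  obtain A' B' where AB': "finite A'" "finite B'" "card A' < k" "card B' < k"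
    "clean_within n k c t A' B'"
  proof (cases "A = {} \<or> B = {}")
    case True
    with clean have "clean_within n k c t {} {}"
      by (auto simp: clean_within_def)
    with that[of "{}" "{}"] \<open>1 \<le> k\<close> show ?thesis by simp
  next
    case False
    with assms have "0 < card A" "0 < card B"
      by (simp_all add: card_gt_0_iff)
    with that[of A B] assms show ?thesis by simp
  qed
  obtain x where "x \<in> free_lines n k c t 0" "x \<in> free_lines n k c (Suc t) 0" "x \<notin> A'"
    using ex_line_free_twice[OF assms(1) AB'(1,3)] by blast
  moreover obtain y where "y \<in> free_lines n k c t 1" "y \<in> free_lines n k c (Suc t) 1" "y \<notin> B'"
    using ex_line_free_twice[OF assms(1) AB'(2,4)] by blast
  ultimately show thesis
    using that AB'(5) unfolding clean_within_def by blast
qed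

lemma clean_within_freed_lines:
  assumes "3 * k \<le> n" "1 \<le> k" and walk: "\<forall>i<k. rook.player_walk n (c i)"
    and "finite A" "finite B" "card A + card B \<le> k" "clean_within n k c t A B"
  shows "clean_within n k c (Suc t)
    (free_lines n k c (Suc t) 0 - free_lines n k c t 0)
    (free_lines n k c (Suc t) 1 - free_lines n k c t 1)"
proof -
  obtain x0 y0 where
    x0: "x0 \<in> free_lines n k c t 0" "x0 \<in> free_lines n k c (Suc t) 0"
      "\<And>y. y \<in> free_lines n k c t 1 \<Longrightarrow> [x0, y] \<in> rook.dirty n 1 k c t" and
    y0: "y0 \<in> free_lines n k c t 1" "y0 \<in> free_lines n k c (Suc t) 1"
      "\<And>x. x \<in> free_lines n k c t 0 \<Longrightarrow> [x, y0] \<in> rook.dirty n 1 k c t"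
    using ex_surviving_dirty_lines[OF assms(1,2,4-7)] by metis
  have board: "free_lines n k c s j \<subseteq> {1..n}" for s j
    by (auto simp: free_lines_def)
  note unseen = unseen_iff_free_lines[OF walk, THEN iffD2, OF subsetD[OF board] subsetD[OF board]]
  show ?thesis
    unfolding clean_within_def
  proof (intro ballI)
    fix x y
    assume x: "x \<in> free_lines n k c (Suc t) 0" and y: "y \<in> free_lines n k c (Suc t) 1"
    have V: "[x, y] \<in> pverts (hamming_graph 2 n)"
      using subsetD[OF board x] subsetD[OF board y] by simp
    have "[x, y] \<in> rook.dirty n 1 k c (Suc t)"
      if "x \<in> free_lines n k c t 0 \<or> y \<in> free_lines n k c t 1"
      using that
    proof
      assume "x \<in> free_lines n k c t 0"
      then show ?thesis
        unfolding mem_dirty_Suc_iff[OF V] using x y y0 unseen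
        by (intro conjI bexI[of _ "[x, y0]"]) auto
    next
      assume "y \<in> free_lines n k c t 1"
      then show ?thesis
        unfolding mem_dirty_Suc_iff[OF V] using x y x0 unseen
        by (intro conjI bexI[of _ "[x0, y]"]) auto
    qed
    with x y show "[x, y] \<in> rook.dirty n 1 k c (Suc t) \<or>
        x \<in> free_lines n k c (Suc t) 0 - free_lines n k c t 0 \<and>
        y \<in> free_lines n k c (Suc t) 1 - free_lines n k c t 1"
      by blast
  qed
qed

lemma ex_small_clean_rectangle:
  assumes "3 * k \<le> n" "1 \<le> k" and walk: "\<forall>i<k. rook.player_walk n (c i)"
  shows "\<exists>A B. finite A \<and> finite B \<and> card A + card B \<le> k \<and> clean_within n k c t A B"
proof (induct t)
  case 0
  have "clean_within n k c 0 {} {}"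
    unfolding clean_within_def
    using unseen_iff_free_lines[OF walk] by (auto simp: free_lines_def)
  then show ?case
    by (intro exI[of _ "{}"]) simp
next
  case (Suc t)
  then obtain A B where AB: "finite A" "finite B" "card A + card B \<le> k" "clean_within n k c t A B"
    by blast
  have "finite (free_lines n k c (Suc t) j - free_lines n k c t j)" for j
    by (simp add: free_lines_def)
  with clean_within_freed_lines[OF assms AB] card_freed_lines_le[OF walk] show ?case
    by blast
qed

lemma few_cops_fail:
  assumes "3 * k \<le> n" "1 \<le> k"
  shows "\<not> rook.cops_can_see_robber n 1 k"
proof
  assume "rook.cops_can_see_robber n 1 k"
  then obtain c T where walk: "\<forall>i<k. rook.player_walk n (c i)" and T: "rook.dirty n 1 k c T = {}"
    by (auto simp: rook.cops_can_see_robber_iff_clean)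
  obtain A B where AB: "finite A" "finite B" "card A + card B \<le> k" "clean_within n k c T A B"
    using ex_small_clean_rectangle[OF assms walk] by blast
  show False
    using ex_surviving_dirty_lines[OF assms AB] T by (metis empty_iff)
qed

section \<open>More than n / 3 cops clean the board by sweeping its rows\<close>

text \<open>The schedule is that for the board of side \<open>3k - 1\<close>. The three blocks of columns rotated
  through by the cops \<open>1, \<dots>, k - 1\<close> are the residue classes modulo 3 of \<open>3, \<dots>, 3k - 1\<close>; cop \<open>0\<close>
  uses the columns \<open>1\<close> and \<open>2\<close>.\<close>

definition sweep_row :: "nat \<Rightarrow> nat \<Rightarrow> nat \<Rightarrow> nat" where
  "sweep_row k i t = (if i = 0 then 1 + (t + 1) div 2 else 2 * k + i)"

definition sweep_col :: "nat \<Rightarrow> nat \<Rightarrow> nat" where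
  "sweep_col i t = (if i = 0 then 1 + (t div 2) mod 2 else 3 * i + t mod 3)"

text \<open>Truncation at \<open>n\<close> is a retraction of a larger board onto the board of side \<open>n\<close>: it maps
  steps to steps and keeps every line of the smaller board occupied that was occupied.\<close>

definition sweep :: "nat \<Rightarrow> nat \<Rightarrow> nat \<Rightarrow> nat \<Rightarrow> nat list" where
  "sweep n k i t = [min n (sweep_row k i t), min n (sweep_col i t)]"

lemma player_walk_sweep:
  assumes "1 \<le> n"
  shows "rook.player_walk n (sweep n k i)"
proof -
  have "sweep_row k i t = sweep_row k i (Suc t) \<or> sweep_col i t = sweep_col i (Suc t)" for t
    unfolding sweep_row_def sweep_col_def by (cases "even t") (auto elim!: evenE oddE)
  moreover have "1 \<le> sweep_row k i t" "1 \<le> sweep_col i t" for t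
    by (auto simp: sweep_row_def sweep_col_def)
  ultimately show ?thesis
    using assms unfolding rook_player_walk_iff sweep_def by simp metis
qed

lemma unseen_by_sweep:
  assumes "\<not> rook.seen n 1 k (sweep n k) t [x, y]" "x \<in> {1..n}" "y \<in> {1..n}" "i < k"
  shows "x \<noteq> sweep_row k i t" "y \<noteq> sweep_col i t"
proof -
  have "1 \<le> n" using assms(2) by simp
  then have "\<not> collinear (sweep n k i t) [x, y]"
    using assms rook_seen_iff[of k n "sweep n k" "[x, y]" t] player_walk_sweep by auto
  then show "x \<noteq> sweep_row k i t" "y \<noteq> sweep_col i t"
    using assms(2,3) by (auto simp: sweep_def)
qed

lemma unseen_col_by_sweep:
  assumes "\<not> rook.seen n 1 k (sweep n k) t [x, y]" "x \<in> {1..n}" "y \<in> {1..n}" "n < 3 * k"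
  shows "y \<noteq> 1 + (t div 2) mod 2" "3 \<le> y \<Longrightarrow> y mod 3 \<noteq> t mod 3"
proof -
  show "y \<noteq> 1 + (t div 2) mod 2"
    using unseen_by_sweep(2)[OF assms(1-3), of 0] assms by (simp add: sweep_col_def)
  assume "3 \<le> y"
  then have "0 < y div 3" "y div 3 < k"
    using assms(3,4) by auto
  then have "y \<noteq> 3 * (y div 3) + t mod 3"
    using unseen_by_sweep(2)[OF assms(1-3), of "y div 3"] by (simp add: sweep_col_def)
  then show "y mod 3 \<noteq> t mod 3"
    by presburger
qed

text \<open>In an even round cop \<open>0\<close> changes from one of her two columns to the other, so these are
  both cleaned in her turn.\<close>

lemma odd_unseen_twice_by_sweep:
  assumes "n < 3 * k" "odd t"
    and unseen: "\<not> rook.seen n 1 k (sweep n k) t [x, y]"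
      "\<not> rook.seen n 1 k (sweep n k) (Suc t) [x, y]"
    and xy: "x \<in> {1..n}" "y \<in> {1..n}"
  shows "3 \<le> y"
proof -
  obtain m where "t = 2 * m + 1" using \<open>odd t\<close> by (rule oddE)
  then have "y \<noteq> 1 + m mod 2" "y \<noteq> 1 + Suc m mod 2"
    using unseen_col_by_sweep(1)[OF unseen(1) xy assms(1)]
      unseen_col_by_sweep(1)[OF unseen(2) xy assms(1)] by auto
  moreover have "1 \<le> y" using xy by simp
  ultimately show ?thesis by presburger
qed

text \<open>After round \<open>t\<close> the rows up to \<open>(t + 1) div 2\<close> are swept. In them the cells of the column
  block occupied one round earlier are clean, and after even rounds, in which cop \<open>0\<close> has changed
  her column, so are the unseen cells of her two columns.\<close>

definition maybe_dirty :: "nat \<Rightarrow> nat \<Rightarrow> nat \<Rightarrow> bool" where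
  "maybe_dirty t x y \<longleftrightarrow> (x \<le> (t + 1) div 2 \<longrightarrow>
    \<not> (3 \<le> y \<and> (y + 1) mod 3 = t mod 3) \<and> (even t \<longrightarrow> 3 \<le> y))"

text \<open>In a swept row, the block occupied before the turn, the block occupied after it and the clean
  block are the three residue classes, so no column is left for dirt.\<close>

lemma surviving_dirt_above_sweep:
  assumes "n < 3 * k" "x \<in> {1..n}" "y \<in> {1..n}" "maybe_dirty t x y"
    and unseen: "\<not> rook.seen n 1 k (sweep n k) t [x, y]"
      "\<not> rook.seen n 1 k (sweep n k) (Suc t) [x, y]"
  shows "(Suc t + 1) div 2 < x"
proof (rule ccontr)
  assume le: "\<not> ?thesis"
  have k: "0 < k" using assms(1,2) by simp
  note col = unseen_col_by_sweep[OF _ assms(2,3,1)]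
  have "x \<noteq> 1 + (t + 1) div 2"
    using unseen_by_sweep(1)[OF unseen(1) assms(2,3) k] by (simp add: sweep_row_def)
  with le have old: "x \<le> (t + 1) div 2" by linarith
  have "3 \<le> y"
    using old assms(3,4) odd_unseen_twice_by_sweep[OF assms(1) _ unseen] assms(2)
    by (cases "even t") (auto simp: maybe_dirty_def)
  then have "y mod 3 \<noteq> t mod 3" "y mod 3 \<noteq> Suc t mod 3" "(y + 1) mod 3 \<noteq> t mod 3"
    using col(2)[OF unseen(1)] col(2)[OF unseen(2)] old assms(4) by (auto simp: maybe_dirty_def)
  moreover have "y mod 3 < 3" "t mod 3 < 3" by simp_all
  ultimately show False by (simp add: mod_Suc split: if_splits)
qed

text \<open>Dirt that survives the cops' turn lies above the sweep, so it can re-enter a swept row,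
  including the one that cop \<open>0\<close> has just left, only along its own column. As it was unseen before
  the turn, that column is not one that was occupied then.\<close>

lemma dirty_invariant:
  assumes "n < 3 * k" "[x, y] \<in> rook.dirty n 1 k (sweep n k) t"
  shows "maybe_dirty t x y"
  using assms(2)
proof (induct t arbitrary: x y)
  case 0
  then have "1 \<le> x"
    using subsetD[OF dirty_subset_pverts] by fastforce
  then show ?case
    by (simp add: maybe_dirty_def)
next
  case (Suc t)
  have V: "[x, y] \<in> pverts (hamming_graph 2 n)"
    using Suc.prems dirty_subset_pverts by blast
  obtain u where u: "u \<in> rook.dirty n 1 k (sweep n k) t"
    "\<not> rook.seen n 1 k (sweep n k) (Suc t) u" "collinear u [x, y]"
    using Suc.prems unfolding mem_dirty_Suc_iff[OF V] by blast
  obtain a b where ab: "u = [a, b]" "a \<in> {1..n}" "b \<in> {1..n}"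
    using u(1) subsetD[OF dirty_subset_pverts] unfolding mem_pverts_rook by blast
  have unseen: "\<not> rook.seen n 1 k (sweep n k) t [a, b]"
    "\<not> rook.seen n 1 k (sweep n k) (Suc t) [a, b]"
    using mem_dirty_imp_unseen u ab by blast+
  have above: "(Suc t + 1) div 2 < a"
    using surviving_dirt_above_sweep[OF assms(1) ab(2,3) _ unseen] Suc.hyps u(1) ab(1) by blast
  show ?case
    unfolding maybe_dirty_def
  proof (intro impI)
    assume "x \<le> (Suc t + 1) div 2"
    with above u(3) ab(1) have [simp]: "b = y" by auto
    note col = unseen_col_by_sweep[OF _ ab(2,3) assms(1)]
    have "3 \<le> y" if "even (Suc t)"
      using odd_unseen_twice_by_sweep[OF assms(1) _ unseen ab(2,3)] that by simp
    moreover have "(y + 1) mod 3 \<noteq> Suc t mod 3" if "3 \<le> y"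
      using col(2)[OF unseen(1)] that by simp presburger
    ultimately show "\<not> (3 \<le> y \<and> (y + 1) mod 3 = Suc t mod 3) \<and> (even (Suc t) \<longrightarrow> 3 \<le> y)"
      by blast
  qed
qed

lemma many_cops_succeed:
  assumes "n < 3 * k" "1 \<le> n"
  shows "rook.cops_can_see_robber n 1 k"
proof -
  \<comment> \<open>Cop \<open>0\<close> arrives in row \<open>2 * k\<close> in round \<open>?t\<close>; the rows beyond it are held by the other cops.\<close>
  let ?t = "4 * k - 3"
  have k: "0 < k" using assms by simp
  have "rook.dirty n 1 k (sweep n k) (Suc ?t) = {}"
  proof (rule ccontr)
    assume "rook.dirty n 1 k (sweep n k) (Suc ?t) \<noteq> {}"
    then obtain v where v: "v \<in> rook.dirty n 1 k (sweep n k) (Suc ?t)" by blast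
    then have "v \<in> pverts (hamming_graph 2 n)"
      using dirty_subset_pverts by blast
    with v obtain u where u: "u \<in> rook.dirty n 1 k (sweep n k) ?t"
      "\<not> rook.seen n 1 k (sweep n k) (Suc ?t) u"
      using mem_dirty_Suc_iff by blast
    obtain a b where ab: "u = [a, b]" "a \<in> {1..n}" "b \<in> {1..n}"
      using u(1) subsetD[OF dirty_subset_pverts] unfolding mem_pverts_rook by blast
    have unseen: "\<not> rook.seen n 1 k (sweep n k) ?t [a, b]"
      "\<not> rook.seen n 1 k (sweep n k) (Suc ?t) [a, b]"
      using mem_dirty_imp_unseen u ab by blast+
    have "(Suc ?t + 1) div 2 < a"
      using surviving_dirt_above_sweep[OF assms(1) ab(2,3) dirty_invariant unseen] assms(1) u ab
      by blast
    moreover have "a \<noteq> 2 * k"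
      using unseen_by_sweep(1)[OF unseen(1) ab(2,3) k] k by (simp add: sweep_row_def)
    ultimately have "2 * k < a"
      using k by presburger
    moreover from this have "a - 2 * k < k"
      using ab(2) assms(1) by auto
    ultimately show False
      using unseen_by_sweep(1)[OF unseen(1) ab(2,3), of "a - 2 * k"] by (simp add: sweep_row_def)
  qed
  then show ?thesis
    unfolding rook.cops_can_see_robber_iff_clean using player_walk_sweep[OF assms(2)] by blast
qed

section \<open>The seeing cop number\<close>

theorem theorem3p2:
  fixes n :: nat
  assumes "n \<ge> 1"
  shows "int (pair_graph.seeing_cop_number (hamming_graph 2 n) 1) = \<lceil>(real n + 1) / 3\<rceil>"
proof -
  have iff: "1 \<le> k \<and> rook.cops_can_see_robber n 1 k \<longleftrightarrow> n < 3 * k" for k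
    using few_cops_fail[of k n] many_cops_succeed[of n k] assms by (cases "n < 3 * k") auto
  have "rook.seeing_cop_number n 1 = (LEAST k. n < 3 * k)"
    unfolding rook.seeing_cop_number_def iff ..
  also have "\<dots> = n div 3 + 1"
    by (rule Least_equality) presburger+
  also have "int (n div 3 + 1) = \<lceil>(real n + 1) / 3\<rceil>"
  proof (rule ceiling_unique[symmetric])
    have "n < 3 * (n div 3 + 1)" "3 * (n div 3) \<le> n"
      by presburger+
    then have "real (n + 1) \<le> real (3 * (n div 3 + 1))" "real (3 * (n div 3)) \<le> real n"
      by (simp_all only: of_nat_le_iff)
    then show "of_int (int (n div 3 + 1)) - 1 < (real n + 1) / 3"
      "(real n + 1) / 3 \<le> of_int (int (n div 3 + 1))"
      by simp_all
  qed
  finally show ?thesis .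
qed

end
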